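(* Let $k$ be a field, let $a\in k$ with $a(1-27a)\neq 0$, and let $H\subset\mathbb{P}^2$ be the twisted Hessian elliptic curve $$ H:\ aX^3+Y^3+Z^3=XYZ,\qquad O=(0:1:-1). $$ Then the tripling map $[3]$ on $H$ can be evaluated with $8\mathbf{M}+4\mathbf{S}+2\mathbf{m}$.
   Context: Complexity convention: $\mathbf{M}$, $\mathbf{S}$ and $\mathbf{m}$ denote the cost of a multiplication, of a squaring, and of a multiplication by the curve constant $a$. The map $[3]:H\to H$ can be evaluated with $\alpha\mathbf{M}+\beta\mathbf{S}+\gamma\mathbf{m}$ if there is a straight-line program over $k$ which, given homogeneous coordinates $(X,Y,Z)$ of any point $P$ of $H$, outputs homogeneous coordinates of $[3]P$, using at most $\alpha$ multiplications of two computed quantities, at most $\beta$ squarings of a computed quantity and at most $\gamma$ multiplications by the constant $a$; additions, subtractions and multiplications by fixed small integers are not counted. *)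

theory Defs
  imports
    "HOL-Computational_Algebra.Polynomial"
    "HOL-Library.Multiset"
    "HOL-Algebra.Algebraic_Closure_Type"
begin

section \<open>The projective plane\<close>

type_synonym 'a triple = "'a \<times> 'a \<times> 'a"

definition same_point :: "'a::field triple \<Rightarrow> 'a triple \<Rightarrow> bool" where
  "same_point = (\<lambda>(x, y, z) (x', y', z').
     (x, y, z) \<noteq> (0, 0, 0) \<and> (\<exists>c. c \<noteq> 0 \<and> (x', y', z') = (c * x, c * y, c * z)))"

lemma part_equivp_same_point: "part_equivp (same_point :: 'a::field triple \<Rightarrow> 'a triple \<Rightarrow> bool)"
proof (rule part_equivpI)
  have "same_point (1, 0, 0) (1, 0, 0 :: 'a)"
    unfolding same_point_def by (auto intro!: exI[of _ 1])
  thus "\<exists>v :: 'a triple. same_point v v" ..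
  show "symp (same_point :: 'a triple \<Rightarrow> _)"
  proof (rule sympI)
    fix v w :: "'a triple"
    assume "same_point v w"
    then obtain x y z c where *: "v = (x, y, z)" "v \<noteq> (0, 0, 0)" "c \<noteq> 0"
        "w = (c * x, c * y, c * z)"
      by (auto simp: same_point_def split: prod.splits)
    thus "same_point w v"
      by (auto simp: same_point_def intro!: exI[of _ "inverse c"])
  qed
  show "transp (same_point :: 'a triple \<Rightarrow> _)"
  proof (rule transpI)
    fix u v w :: "'a triple"
    assume "same_point u v" "same_point v w"
    then obtain x y z c d where "u = (x, y, z)" "u \<noteq> (0, 0, 0)" "c \<noteq> 0" "d \<noteq> 0"
        "w = (d * (c * x), d * (c * y), d * (c * z))"
      by (auto simp: same_point_def split: prod.splits)
    thus "same_point u w"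
      by (auto simp: same_point_def mult.assoc intro!: exI[of _ "d * c"])
  qed
qed

quotient_type (overloaded) 'a proj2 = "'a::field triple" / partial: same_point
  by (rule part_equivp_same_point)

definition point :: "'a::field triple \<Rightarrow> 'a proj2" where
  "point v = abs_proj2 v"

definition homogeneous_coords :: "'a::field triple \<Rightarrow> 'a proj2 \<Rightarrow> bool" where
  "homogeneous_coords v P \<longleftrightarrow> v \<noteq> (0, 0, 0) \<and> point v = P"

lemma point_eq_iff:
  assumes "v \<noteq> (0, 0, 0)" "w \<noteq> (0, 0, 0)"
  shows "point v = point w \<longleftrightarrow> same_point v w"
proof -
  have refl: "same_point u u" if "u \<noteq> (0, 0, 0)" for u :: "'a triple"
    using that by (auto simp: same_point_def intro!: exI[of _ 1] split: prod.splits)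
  show ?thesis
    unfolding point_def
    using Quotient_rel[OF Quotient_proj2, of v w] refl[OF assms(1)] refl[OF assms(2)] by simp
qed

lemma ex_homogeneous_coords: "\<exists>v. homogeneous_coords v P"
proof -
  have "same_point (rep_proj2 P) (rep_proj2 P)"
    by (rule Quotient_rep_reflp[OF Quotient_proj2])
  moreover have "point (rep_proj2 P) = P"
    unfolding point_def by (rule Quotient_abs_rep[OF Quotient_proj2])
  ultimately show ?thesis
    by (auto simp: homogeneous_coords_def same_point_def split: prod.splits)
qed

text \<open>A line is given by the coefficients of a nonzero linear form.\<close>

definition vanishes :: "'a::field triple \<Rightarrow> 'a triple \<Rightarrow> bool" where
  "vanishes = (\<lambda>(l, m, n) (x, y, z). l * x + m * y + n * z = 0)"

definition on_line :: "'a::field triple \<Rightarrow> 'a proj2 \<Rightarrow> bool" where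
  "on_line L P \<longleftrightarrow> (\<exists>v. homogeneous_coords v P \<and> vanishes L v)"


section \<open>The twisted Hessian curve and its group law\<close>

text \<open>The form is used both over a field and, to restrict it to a line, over univariate
  polynomials.\<close>

definition hessian_form :: "'a::comm_ring_1 \<Rightarrow> 'a triple \<Rightarrow> 'a" where
  "hessian_form a = (\<lambda>(x, y, z). a * x ^ 3 + y ^ 3 + z ^ 3 - x * y * z)"

definition hessian_curve :: "'a::field \<Rightarrow> 'a proj2 set" where
  "hessian_curve a = {P. \<exists>v. homogeneous_coords v P \<and> hessian_form a v = 0}"

definition hessian_zero :: "'a::field proj2" where
  "hessian_zero = point (0, 1, -1)"

text \<open>The form at \<open>v + t w\<close>, as a polynomial in \<open>t\<close>. If \<open>v\<close> and \<open>w\<close> represent distinct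
  points and the polynomial is nonzero, its order at \<open>0\<close> is the intersection multiplicity at the
  point of \<open>v\<close> of the curve with the line through the two points.\<close>

definition restrict_form :: "'a::field \<Rightarrow> 'a triple \<Rightarrow> 'a triple \<Rightarrow> 'a poly" where
  "restrict_form a = (\<lambda>(x, y, z) (x', y', z').
     hessian_form [:a:] ([:x, x':], [:y, y':], [:z, z':]))"

text \<open>The divisor cut out on the curve by the line \<open>L\<close> is \<open>P + Q + R\<close>.\<close>

definition line_section ::
    "'a::field \<Rightarrow> 'a triple \<Rightarrow> 'a proj2 \<Rightarrow> 'a proj2 \<Rightarrow> 'a proj2 \<Rightarrow> bool" where
  "line_section a L P Q R \<longleftrightarrow>
     L \<noteq> (0, 0, 0) \<and> on_line L P \<and> on_line L Q \<and> on_line L R \<and>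
     (\<forall>S T v w. on_line L S \<and> on_line L T \<and> S \<noteq> T \<and>
        homogeneous_coords v S \<and> homogeneous_coords w T \<longrightarrow>
        restrict_form a v w \<noteq> 0 \<and>
        Polynomial.order 0 (restrict_form a v w) = count {#P, Q, R#} S)"

text \<open>The chord-tangent construction: the third intersection point of the line through
  \<open>P\<close> and \<open>Q\<close> (the tangent line at \<open>P\<close> if \<open>P = Q\<close>).\<close>

definition third_point :: "'a::field \<Rightarrow> 'a proj2 \<Rightarrow> 'a proj2 \<Rightarrow> 'a proj2" where
  "third_point a P Q = (THE R. \<exists>L. line_section a L P Q R)"

definition hessian_add :: "'a::field \<Rightarrow> 'a proj2 \<Rightarrow> 'a proj2 \<Rightarrow> 'a proj2" where
  "hessian_add a P Q = third_point a hessian_zero (third_point a P Q)"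

definition hessian_mult :: "'a::field \<Rightarrow> nat \<Rightarrow> 'a proj2 \<Rightarrow> 'a proj2" where
  "hessian_mult a n P = (hessian_add a P ^^ n) hessian_zero"


section \<open>Straight-line programs\<close>

text \<open>Registers \<open>0\<close>, \<open>1\<close>, \<open>2\<close> hold the input coordinates, and every instruction appends one
  register. The constant \<open>a\<close> occurs only through \<open>MulConst\<close>, and there are no other constants
  from the field. No bound is put on the integers in \<open>IntMul\<close>: by repeated addition every
  integer multiple is free anyway.\<close>

datatype instr =
    Mul nat nat
  | Sqr nat
  | MulConst nat
  | Add nat nat
  | Sub nat nat
  | IntMul int nat

primrec operands :: "instr \<Rightarrow> nat set" where
  "operands (Mul i j) = {i, j}"
| "operands (Sqr i) = {i}"
| "operands (MulConst i) = {i}"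
| "operands (Add i j) = {i, j}"
| "operands (Sub i j) = {i, j}"
| "operands (IntMul c i) = {i}"

primrec instr_value :: "'a::comm_ring_1 \<Rightarrow> 'a list \<Rightarrow> instr \<Rightarrow> 'a" where
  "instr_value a rs (Mul i j) = rs ! i * rs ! j"
| "instr_value a rs (Sqr i) = (rs ! i) ^ 2"
| "instr_value a rs (MulConst i) = a * rs ! i"
| "instr_value a rs (Add i j) = rs ! i + rs ! j"
| "instr_value a rs (Sub i j) = rs ! i - rs ! j"
| "instr_value a rs (IntMul c i) = of_int c * rs ! i"

text \<open>A program consists of its instructions and the registers of the three outputs.\<close>

type_synonym slp = "instr list \<times> nat triple"

definition well_formed :: "slp \<Rightarrow> bool" where
  "well_formed = (\<lambda>(is, (i, j, k)).
     (\<forall>n < length is. \<forall>r \<in> operands (is ! n). r < 3 + n) \<and>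
     i < 3 + length is \<and> j < 3 + length is \<and> k < 3 + length is)"

definition run :: "'a::comm_ring_1 \<Rightarrow> slp \<Rightarrow> 'a triple \<Rightarrow> 'a triple" where
  "run a = (\<lambda>(is, (i, j, k)) (x, y, z).
     let rs = foldl (\<lambda>rs c. rs @ [instr_value a rs c]) [x, y, z] is
     in (rs ! i, rs ! j, rs ! k))"

definition num_mul :: "slp \<Rightarrow> nat" where
  "num_mul p = length (filter (\<lambda>c. case c of Mul _ _ \<Rightarrow> True | _ \<Rightarrow> False) (fst p))"

definition num_sqr :: "slp \<Rightarrow> nat" where
  "num_sqr p = length (filter (\<lambda>c. case c of Sqr _ \<Rightarrow> True | _ \<Rightarrow> False) (fst p))"

definition num_mul_const :: "slp \<Rightarrow> nat" where
  "num_mul_const p = length (filter (\<lambda>c. case c of MulConst _ \<Rightarrow> True | _ \<Rightarrow> False) (fst p))"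

text \<open>The points of the curve are taken over an algebraic closure of the base field, so that the
  program computes the morphism and not merely its values at the rational points
  (of which a small finite field has very few).\<close>

definition evaluable_with ::
    "'k::field \<Rightarrow> ('k alg_closure proj2 \<Rightarrow> 'k alg_closure proj2) \<Rightarrow> nat \<Rightarrow> nat \<Rightarrow> nat \<Rightarrow> bool" where
  "evaluable_with a f \<alpha> \<beta> \<gamma> \<longleftrightarrow>
     (\<exists>p. well_formed p \<and> num_mul p \<le> \<alpha> \<and> num_sqr p \<le> \<beta> \<and> num_mul_const p \<le> \<gamma> \<and>
        (\<forall>P \<in> hessian_curve (to_ac a). \<forall>v. homogeneous_coords v P \<longrightarrow>
           homogeneous_coords (run (to_ac a) p v) (f P)))"

end

theory Submission
  imports Defs
begin

text \<open>Put \<open>u = aX\<^sup>3\<close>, \<open>v = Y\<^sup>3\<close>, \<open>w = Z\<^sup>3\<close>, so that \<open>uvw = a(u + v + w)\<^sup>3\<close> on the curve; this is the quotient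
  of \<open>H\<close> by a subgroup scheme of order 3, and \<open>[3]\<close> is the composition with the dual isogeny, whose
  coordinates are cubic forms in \<open>u, v, w\<close> invariant under cyclic permutations. With \<open>s = u - w\<close>,
  \<open>q = v - w\<close> and \<open>N = (s - q)\<^sup>2 + sq\<close>, the triple is
  \<open>((u + v + w)N : wN + s\<^sup>2q : wN + sq\<^sup>2)\<close> in every characteristic. Three cubes, and then
  \<open>sq\<close>, \<open>(s - q)\<^sup>2\<close> and four more products, cost 8M + 4S + 1m.

  That the formula computes \<open>P + (P + (P + O))\<close> is a polynomial identity for the chord through \<open>P\<close>
  and \<open>2P\<close>. It applies because a line on which the form splits into three linear factors cuts out
  the divisor of their zeros, and because \<open>H\<close> is smooth, so that a line meeting \<open>H\<close> at \<open>P\<close> with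
  multiplicity 2 is the tangent.\<close>

section \<open>Linear algebra of triples\<close>

definition cross :: "'a::comm_ring_1 triple \<Rightarrow> 'a triple \<Rightarrow> 'a triple" where
  "cross = (\<lambda>(x, y, z) (x', y', z'). (y * z' - z * y', z * x' - x * z', x * y' - y * x'))"

text \<open>Doubles as scalar multiplication: \<open>comb c v 0 (0, 0, 0)\<close> is
  \<open>c\<close> times \<open>v\<close>.\<close>

definition comb :: "'a::comm_ring_1 \<Rightarrow> 'a triple \<Rightarrow> 'a \<Rightarrow> 'a triple \<Rightarrow> 'a triple" where
  "comb = (\<lambda>\<alpha> (x, y, z) \<beta> (x', y', z'). (\<alpha> * x + \<beta> * x', \<alpha> * y + \<beta> * y', \<alpha> * z + \<beta> * z'))"

definition hessian_gradient :: "'a::comm_ring_1 \<Rightarrow> 'a triple \<Rightarrow> 'a triple" where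
  "hessian_gradient a = (\<lambda>(x, y, z). (3 * a * x ^ 2 - y * z, 3 * y ^ 2 - x * z, 3 * z ^ 2 - x * y))"

definition dot :: "'a::comm_ring_1 triple \<Rightarrow> 'a triple \<Rightarrow> 'a" where
  "dot = (\<lambda>(l, m, n) (x, y, z). l * x + m * y + n * z)"

lemma vanishes_iff_dot: "vanishes L v \<longleftrightarrow> dot L v = 0"
  by (auto simp: vanishes_def dot_def split: prod.splits)

text \<open>Taylor expansion of a cubic form along a line: the mixed coefficients are derivatives at
  one point in the direction of the other, so no denominators occur.\<close>

lemma hessian_form_comb:
  "hessian_form a (comb \<alpha> p \<beta> n) =
     \<alpha> ^ 3 * hessian_form a p + \<alpha> ^ 2 * \<beta> * dot (hessian_gradient a p) n
     + \<alpha> * \<beta> ^ 2 * dot (hessian_gradient a n) p + \<beta> ^ 3 * hessian_form a n"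
  by (cases p; cases n)
     (simp add: hessian_form_def comb_def dot_def hessian_gradient_def algebra_simps eval_nat_numeral)

text \<open>Euler's relation in degree 3.\<close>

lemma dot_hessian_gradient: "dot (hessian_gradient a p) p = 3 * hessian_form a p"
  by (cases p) (simp add: dot_def hessian_gradient_def hessian_form_def algebra_simps eval_nat_numeral)

lemma cross_comb: "cross (comb \<alpha> p \<beta> n) (comb \<gamma> p \<delta> n) = comb (\<alpha> * \<delta> - \<beta> * \<gamma>) (cross p n) 0 (0,0,0)"
  by (cases p; cases n) (simp add: cross_def comb_def algebra_simps)

lemma proportional_if_cross_eq_0:
  fixes v w :: "'a::field triple"
  assumes "v \<noteq> (0, 0, 0)" "cross v w = (0, 0, 0)"
  shows "\<exists>c. w = comb c v 0 (0, 0, 0)"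
proof -
  obtain x y z where v: "v = (x, y, z)" by (cases v)
  obtain x' y' z' where w: "w = (x', y', z')" by (cases w)
  have eqs: "y * z' = z * y'" "z * x' = x * z'" "x * y' = y * x'"
    using assms by (simp_all add: v w cross_def)
  consider "x \<noteq> 0" | "y \<noteq> 0" | "z \<noteq> 0"
    using assms(1) by (auto simp: v)
  thus ?thesis
  proof cases
    case 1
    thus ?thesis using eqs by (intro exI[of _ "x' / x"]) (simp add: v w comb_def field_simps)
  next
    case 2
    thus ?thesis using eqs by (intro exI[of _ "y' / y"]) (simp add: v w comb_def field_simps)
  next
    case 3
    thus ?thesis using eqs by (intro exI[of _ "z' / z"]) (simp add: v w comb_def field_simps)
  qed
qed

lemma same_point_iff_cross:
  fixes v w :: "'a::field triple"
  assumes "v \<noteq> (0, 0, 0)" "w \<noteq> (0, 0, 0)"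
  shows "same_point v w \<longleftrightarrow> cross v w = (0, 0, 0)"
proof
  assume "same_point v w"
  thus "cross v w = (0, 0, 0)"
    by (auto simp: same_point_def cross_def split: prod.splits)
next
  assume "cross v w = (0, 0, 0)"
  then obtain c where "w = comb c v 0 (0, 0, 0)"
    using proportional_if_cross_eq_0 assms(1) by blast
  thus "same_point v w"
    using assms by (cases v) (auto simp: same_point_def comb_def)
qed

lemma point_eq_iff_cross:
  fixes v w :: "'a::field triple"
  assumes "v \<noteq> (0, 0, 0)" "w \<noteq> (0, 0, 0)"
  shows "point v = point w \<longleftrightarrow> cross v w = (0, 0, 0)"
  using point_eq_iff same_point_iff_cross assms by blast

lemma ex_dot_neq_0:
  assumes "L \<noteq> (0, 0, 0)"
  shows "\<exists>e. dot L e \<noteq> 0"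
proof -
  obtain l m n where L: "L = (l, m, n)" by (cases L)
  have "dot L (1, 0, 0) = l" "dot L (0, 1, 0) = m" "dot L (0, 0, 1) = n"
    by (simp_all add: L dot_def)
  thus ?thesis using assms by (metis L)
qed

text \<open>Four vectors in 3-space are dependent, with 3 by 3 determinants as coefficients, here
  written as triple products.\<close>

lemma cramer_identity:
  "comb (dot (cross p n) e) v 0 (0, 0, 0) =
     comb 1 (comb (dot (cross v n) e) p (dot (cross p v) e) n) (dot (cross p n) v) e"
  by (cases p; cases n; cases v; cases e) (simp add: comb_def cross_def dot_def algebra_simps)

lemma spanned_if_on_line:
  fixes p n v :: "'a::field triple"
  assumes "cross p n \<noteq> (0, 0, 0)" "dot (cross p n) v = 0"
  shows "\<exists>\<alpha> \<beta>. v = comb \<alpha> p \<beta> n"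
proof -
  obtain e where e: "dot (cross p n) e \<noteq> 0"
    using ex_dot_neq_0 assms(1) by blast
  define d where "d = dot (cross p n) e"
  have "comb d v 0 (0, 0, 0) = comb (dot (cross v n) e) p (dot (cross p v) e) n"
    using cramer_identity[of p n e v] assms(2)
    by (simp add: d_def comb_def split: prod.splits)
  hence "v = comb (dot (cross v n) e / d) p (dot (cross p v) e / d) n"
    using e by (auto simp: comb_def field_simps simp flip: d_def split: prod.splits)
  thus ?thesis by blast
qed

lemma cross_cross: "cross (cross p q) L = comb (dot p L) q (- dot q L) p"
  by (cases p; cases q; cases L) (simp add: comb_def cross_def dot_def algebra_simps)

lemma dot_commute: "dot v w = dot w v"
  by (cases v; cases w) (simp add: dot_def mult.commute)

lemma dot_cross [simp]: "dot (cross p n) p = 0" "dot (cross p n) n = 0"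
  by (cases p; cases n; simp add: cross_def dot_def algebra_simps)+

lemma dot_comb: "dot L (comb \<alpha> p \<beta> n) = \<alpha> * dot L p + \<beta> * dot L n"
  by (cases p; cases n; cases L) (simp add: comb_def dot_def algebra_simps)

lemma cross_zero_right [simp]: "cross v (0, 0, 0) = (0, 0, 0)"
  by (cases v) (simp add: cross_def)

lemma cross_zero_left [simp]: "cross (0, 0, 0) v = (0, 0, 0)"
  by (cases v) (simp add: cross_def)

lemma comb_zero_coeffs [simp]: "comb 0 p 0 n = (0, 0, 0)"
  by (cases p; cases n) (simp add: comb_def)

lemma comb_unit [simp]: "comb 1 p 0 n = p" "comb 0 p 1 n = n"
  by (cases p; cases n; simp add: comb_def)+

lemma comb_eq_0_iff:
  fixes v w :: "'a::field triple"
  assumes "v \<noteq> (0, 0, 0)"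
  shows "comb c v 0 w = (0, 0, 0) \<longleftrightarrow> c = 0"
  using assms by (cases v; cases w) (auto simp: comb_def)

lemma neq_0_if_cross_neq_0:
  assumes "cross v w \<noteq> (0, 0, 0)"
  shows "v \<noteq> (0, 0, 0)" "w \<noteq> (0, 0, 0)"
  using assms by auto

lemma cross_comb_eq_0_iff:
  fixes p n :: "'a::field triple"
  assumes "cross p n \<noteq> (0, 0, 0)"
  shows "cross (comb \<alpha> p \<beta> n) (comb \<gamma> p \<delta> n) = (0, 0, 0) \<longleftrightarrow> \<alpha> * \<delta> = \<beta> * \<gamma>"
  unfolding cross_comb comb_eq_0_iff[OF assms] by simp

lemma comb_neq_0:
  fixes p n :: "'a::field triple"
  assumes "cross p n \<noteq> (0, 0, 0)" "\<alpha> \<noteq> 0 \<or> \<beta> \<noteq> 0"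
  shows "comb \<alpha> p \<beta> n \<noteq> (0, 0, 0)"
proof
  assume "comb \<alpha> p \<beta> n = (0, 0, 0)"
  hence "cross (comb \<alpha> p \<beta> n) (comb 0 p 1 n) = (0, 0, 0)"
    "cross (comb \<alpha> p \<beta> n) (comb 1 p 0 n) = (0, 0, 0)" by simp_all
  thus False
    unfolding cross_comb_eq_0_iff[OF assms(1)] using assms(2) by auto
qed

lemma binary_cubic_eq_prod:
  fixes \<alpha> \<beta> :: "'a::comm_ring_1"
  shows "\<alpha> ^ 3 * (a1 * a2 * a3) + \<alpha> ^ 2 * \<beta> * (a1 * a2 * b3 + a1 * b2 * a3 + b1 * a2 * a3)
     + \<alpha> * \<beta> ^ 2 * (a1 * b2 * b3 + b1 * a2 * b3 + b1 * b2 * a3) + \<beta> ^ 3 * (b1 * b2 * b3)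
     = (a1 * \<alpha> + b1 * \<beta>) * (a2 * \<alpha> + b2 * \<beta>) * (a3 * \<alpha> + b3 * \<beta>)"
  by (simp add: algebra_simps power2_eq_square power3_eq_cube)

section \<open>Lines and the curve\<close>

lemma restrict_form_comb:
  fixes p n :: "'a::field triple"
  shows "restrict_form a (comb \<alpha> p \<beta> n) (comb \<gamma> p \<delta> n) =
    [:\<alpha>, \<gamma>:] ^ 3 * [:hessian_form a p:]
    + [:\<alpha>, \<gamma>:] ^ 2 * [:\<beta>, \<delta>:] * [:dot (hessian_gradient a p) n:]
    + [:\<alpha>, \<gamma>:] * [:\<beta>, \<delta>:] ^ 2 * [:dot (hessian_gradient a n) p:]
    + [:\<beta>, \<delta>:] ^ 3 * [:hessian_form a n:]"
proof -
  obtain x y z where p: "p = (x, y, z)" by (cases p)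
  obtain x' y' z' where n: "n = (x', y', z')" by (cases n)
  let ?p = "([:x:], [:y:], [:z:])" and ?n = "([:x':], [:y':], [:z':])"
  have num: "(3 :: 'a poly) = [:3:]" by (simp add: numeral_poly)
  have const:
    "hessian_form [:a:] ?p = [:hessian_form a p:]"
    "hessian_form [:a:] ?n = [:hessian_form a n:]"
    "dot (hessian_gradient [:a:] ?p) ?n = [:dot (hessian_gradient a p) n:]"
    "dot (hessian_gradient [:a:] ?n) ?p = [:dot (hessian_gradient a n) p:]"
    by (simp_all add: hessian_form_def dot_def hessian_gradient_def p n num
          power3_eq_cube power2_eq_square mult_ac)
  have "restrict_form a (comb \<alpha> p \<beta> n) (comb \<gamma> p \<delta> n) =
      hessian_form [:a:] (comb [:\<alpha>, \<gamma>:] ?p [:\<beta>, \<delta>:] ?n)"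
    by (simp add: restrict_form_def comb_def p n mult.commute)
  thus ?thesis
    unfolding hessian_form_comb const .
qed

lemma restrict_form_comb_eq_prod:
  fixes p n :: "'a::field triple"
  assumes "hessian_form a p = a1 * a2 * a3"
    and "dot (hessian_gradient a p) n = a1 * a2 * b3 + a1 * b2 * a3 + b1 * a2 * a3"
    and "dot (hessian_gradient a n) p = a1 * b2 * b3 + b1 * a2 * b3 + b1 * b2 * a3"
    and "hessian_form a n = b1 * b2 * b3"
  shows "restrict_form a (comb \<alpha> p \<beta> n) (comb \<gamma> p \<delta> n) =
    [:a1 * \<alpha> + b1 * \<beta>, a1 * \<gamma> + b1 * \<delta>:] * [:a2 * \<alpha> + b2 * \<beta>, a2 * \<gamma> + b2 * \<delta>:]
    * [:a3 * \<alpha> + b3 * \<beta>, a3 * \<gamma> + b3 * \<delta>:]"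
proof -
  have const: "[:s * t:] = [:s:] * [:t:]" "[:s + t:] = [:s:] + [:t:]" for s t :: 'a by simp_all
  have lin: "[:s * \<alpha> + t * \<beta>, s * \<gamma> + t * \<delta>:] = [:s:] * [:\<alpha>, \<gamma>:] + [:t:] * [:\<beta>, \<delta>:]"
    for s t by simp
  show ?thesis
    unfolding restrict_form_comb assms lin unfolding const by (rule binary_cubic_eq_prod)
qed

lemma order_0_linear:
  fixes s t :: "'a::field"
  assumes "s \<noteq> 0 \<or> t \<noteq> 0"
  shows "Polynomial.order 0 [:s, t:] = (if s = 0 then 1 else 0)"
proof (cases "s = 0")
  case True
  hence t: "t \<noteq> 0" and "[:s, t:] = smult t [:0, 1:]" using assms by auto
  hence "Polynomial.order 0 [:s, t:] = Polynomial.order 0 [:0, 1 :: 'a:]"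
    by (metis order_smult)
  thus ?thesis using True order_power_n_n[of "0::'a" 1] by simp
next
  case False
  thus ?thesis by (simp add: order_0I)
qed


lemma same_point_imp_comb:
  assumes "same_point v w"
  shows "\<exists>c. w = comb c v 0 (0, 0, 0)"
  using assms by (auto simp: same_point_def comb_def)

lemma on_line_iff:
  assumes "homogeneous_coords v P"
  shows "on_line L P \<longleftrightarrow> dot L v = 0"
proof
  assume "on_line L P"
  then obtain w where w: "homogeneous_coords w P" "dot L w = 0"
    by (auto simp: on_line_def vanishes_iff_dot)
  hence "same_point w v"
    using assms point_eq_iff by (metis homogeneous_coords_def)
  then obtain c where "v = comb c w 0 (0, 0, 0)"
    using same_point_imp_comb by blast
  thus "dot L v = 0"
    using w(2) by (simp add: dot_comb)
next
  assume "dot L v = 0"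
  thus "on_line L P"
    unfolding on_line_def vanishes_iff_dot using assms by blast
qed

lemma homogeneous_coords_point: "v \<noteq> (0, 0, 0) \<Longrightarrow> homogeneous_coords v (point v)"
  by (simp add: homogeneous_coords_def)

text \<open>The zero of \<open>a1 * \<alpha> + b1 * \<beta>\<close> is \<open>b1 p - a1 n\<close>.
  Along any \<open>v + t w\<close> each factor becomes a nonzero polynomial of degree at most 1, of
  order 1 at 0 exactly when \<open>S\<close> is its zero; orders add over the factors.\<close>

lemma line_section_if_form_splits:
  fixes p n :: "'a::field triple"
  assumes indep: "cross p n \<noteq> (0, 0, 0)"
    and forms: "a1 \<noteq> 0 \<or> b1 \<noteq> 0" "a2 \<noteq> 0 \<or> b2 \<noteq> 0" "a3 \<noteq> 0 \<or> b3 \<noteq> 0"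
    and coeffs: "hessian_form a p = a1 * a2 * a3"
      "dot (hessian_gradient a p) n = a1 * a2 * b3 + a1 * b2 * a3 + b1 * a2 * a3"
      "dot (hessian_gradient a n) p = a1 * b2 * b3 + b1 * a2 * b3 + b1 * b2 * a3"
      "hessian_form a n = b1 * b2 * b3"
  shows "line_section a (cross p n)
    (point (comb b1 p (- a1) n)) (point (comb b2 p (- a2) n)) (point (comb b3 p (- a3) n))"
proof -
  define Z where "Z s t = point (comb t p (- s) n)" for s t
  have on_line: "on_line (cross p n) (Z s t)" if "s \<noteq> 0 \<or> t \<noteq> 0" for s t
    unfolding Z_def
    by (subst on_line_iff[OF homogeneous_coords_point]) (use that indep in \<open>auto simp: comb_neq_0 dot_comb\<close>)
  have order: "Polynomial.order 0 (restrict_form a v w) = count {#Z a1 b1, Z a2 b2, Z a3 b3#} S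
      \<and> restrict_form a v w \<noteq> 0"
    if hyps: "on_line (cross p n) S" "on_line (cross p n) T" "S \<noteq> T"
      "homogeneous_coords v S" "homogeneous_coords w T" for S T v w
  proof -
    obtain \<alpha> \<beta> where v: "v = comb \<alpha> p \<beta> n"
      using hyps on_line_iff spanned_if_on_line[OF indep] by blast
    obtain \<gamma> \<delta> where w: "w = comb \<gamma> p \<delta> n"
      using hyps on_line_iff spanned_if_on_line[OF indep] by blast
    have nz: "v \<noteq> (0, 0, 0)" "w \<noteq> (0, 0, 0)" and S: "S = point v" and "T = point w"
      using hyps by (auto simp: homogeneous_coords_def)
    hence "cross v w \<noteq> (0, 0, 0)"
      using hyps(3) point_eq_iff_cross[OF nz] by simp
    hence det: "\<alpha> * \<delta> \<noteq> \<beta> * \<gamma>"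
      unfolding v w cross_comb_eq_0_iff[OF indep] .
    define l where "l s t = [:s * \<alpha> + t * \<beta>, s * \<gamma> + t * \<delta>:]" for s t
    have l: "l s t \<noteq> 0" "Polynomial.order 0 (l s t) = (if S = Z s t then 1 else 0)"
      if st: "s \<noteq> 0 \<or> t \<noteq> 0" for s t
    proof -
      have nonzero: "s * \<alpha> + t * \<beta> \<noteq> 0 \<or> s * \<gamma> + t * \<delta> \<noteq> 0"
      proof (rule ccontr)
        assume "\<not> ?thesis"
        hence "s * \<alpha> + t * \<beta> = 0" "s * \<gamma> + t * \<delta> = 0" by auto
        \<comment> \<open>Cramer's rule: \<open>v\<close> and \<open>w\<close> represent distinct
          points, so a linear form vanishing at both is zero.\<close>
        moreover have "s * (\<alpha> * \<delta> - \<beta> * \<gamma>) = (s * \<alpha> + t * \<beta>) * \<delta> - \<beta> * (s * \<gamma> + t * \<delta>)"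
          "t * (\<alpha> * \<delta> - \<beta> * \<gamma>) = \<alpha> * (s * \<gamma> + t * \<delta>) - (s * \<alpha> + t * \<beta>) * \<gamma>"
          by (simp_all add: algebra_simps)
        ultimately have "s * (\<alpha> * \<delta> - \<beta> * \<gamma>) = 0" "t * (\<alpha> * \<delta> - \<beta> * \<gamma>) = 0" by simp_all
        thus False using st det by auto
      qed
      have "S = Z s t \<longleftrightarrow> cross v (comb t p (- s) n) = (0, 0, 0)"
        unfolding S Z_def
        by (rule point_eq_iff_cross) (use st nz comb_neq_0[OF indep, of t "- s"] in auto)
      also have "\<dots> \<longleftrightarrow> s * \<alpha> + t * \<beta> = 0"
        unfolding v cross_comb_eq_0_iff[OF indep] by (auto simp: algebra_simps add_eq_0_iff)
      finally show "Polynomial.order 0 (l s t) = (if S = Z s t then 1 else 0)"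
        unfolding l_def order_0_linear[OF nonzero] by simp
      show "l s t \<noteq> 0"
        using nonzero by (auto simp: l_def)
    qed
    have "restrict_form a v w = l a1 b1 * l a2 b2 * l a3 b3"
      unfolding v w l_def by (rule restrict_form_comb_eq_prod) fact+
    moreover have "Polynomial.order 0 (l a1 b1 * l a2 b2 * l a3 b3) =
        Polynomial.order 0 (l a1 b1) + Polynomial.order 0 (l a2 b2) + Polynomial.order 0 (l a3 b3)"
      using l(1) forms by (simp add: order_mult)
    ultimately show ?thesis using l forms by auto
  qed
  show ?thesis
    unfolding line_section_def Z_def [symmetric]
    using indep on_line forms order by blast
qed

text \<open>The witness is \<open>cross L e\<close> with \<open>dot v e\<close> nonzero: it lies on
  \<open>L\<close>, and its cross product with \<open>v\<close> is \<open>dot v e\<close> times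
  \<open>L\<close>.\<close>

lemma ex_other_on_line:
  fixes L v :: "'a::field triple"
  assumes "L \<noteq> (0, 0, 0)" "dot L v = 0" "v \<noteq> (0, 0, 0)"
  shows "\<exists>w. dot L w = 0 \<and> cross v w \<noteq> (0, 0, 0)"
proof -
  obtain e where e: "dot v e \<noteq> 0" using ex_dot_neq_0 assms(3) by blast
  have "cross v (cross L e) = comb (dot v e) L (- dot L v) e"
    by (cases v; cases L; cases e) (simp add: cross_def comb_def dot_def algebra_simps)
  hence "cross v (cross L e) \<noteq> (0, 0, 0)"
    using assms e by (simp add: comb_eq_0_iff)
  thus ?thesis using dot_cross(1) by (metis dot_commute)
qed

section \<open>Uniqueness of the third intersection point\<close>

lemma line_section_count:
  assumes "line_section a L P Q R" "homogeneous_coords v S" "dot L v = 0" "dot L w = 0"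
    "cross v w \<noteq> (0, 0, 0)"
  shows "restrict_form a v w \<noteq> 0" "Polynomial.order 0 (restrict_form a v w) = count {#P, Q, R#} S"
proof -
  have v: "v \<noteq> (0, 0, 0)" and S: "S = point v" using assms(2) by (auto simp: homogeneous_coords_def)
  have "w \<noteq> (0, 0, 0)" using assms(5) by auto
  hence w: "homogeneous_coords w (point w)" by (rule homogeneous_coords_point)
  have "S \<noteq> point w"
    unfolding S using assms(5) point_eq_iff_cross[OF v \<open>w \<noteq> (0, 0, 0)\<close>] by simp
  moreover have "on_line L S" "on_line L (point w)"
    using assms on_line_iff w by blast+
  ultimately show "restrict_form a v w \<noteq> 0"
    "Polynomial.order 0 (restrict_form a v w) = count {#P, Q, R#} S"
    using assms(1,2) w unfolding line_section_def by blast+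
qed

text \<open>Proportional lines give the same multiplicities, and comparing those at \<open>R\<close>
  leaves only \<open>R' = R\<close>.\<close>

lemma line_section_unique:
  assumes "line_section a L P Q R" "line_section a L' P Q R'" "cross L L' = (0, 0, 0)"
  shows "R = R'"
proof -
  have L: "L \<noteq> (0, 0, 0)" and R: "on_line L R"
    using assms(1) by (auto simp: line_section_def)
  obtain c where c: "L' = comb c L 0 (0, 0, 0)"
    using proportional_if_cross_eq_0 L assms(3) by blast
  have L': "dot L' x = c * dot L x" for x
    unfolding c using dot_comb by (metis dot_commute add.right_neutral mult_zero_left)
  obtain v where v: "homogeneous_coords v R" using ex_homogeneous_coords by blast
  hence "dot L v = 0" "v \<noteq> (0, 0, 0)"
    using R on_line_iff[OF v] by (auto simp: homogeneous_coords_def)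
  then obtain w where "dot L w = 0" "cross v w \<noteq> (0, 0, 0)"
    using ex_other_on_line L by blast
  hence "count {#P, Q, R#} R = count {#P, Q, R'#} R"
    using line_section_count(2)[OF assms(1) v] line_section_count(2)[OF assms(2) v] \<open>dot L v = 0\<close> L'
    by simp
  thus ?thesis by (auto split: if_splits)
qed

lemma cross_eq_0_trans:
  fixes L M :: "'a::field triple"
  assumes "M \<noteq> (0, 0, 0)" "cross M L = (0, 0, 0)" "cross M L' = (0, 0, 0)"
  shows "cross L L' = (0, 0, 0)"
proof -
  obtain c c' where "L = comb c M 0 (0, 0, 0)" "L' = comb c' M 0 (0, 0, 0)"
    using proportional_if_cross_eq_0 assms by metis
  thus ?thesis by (cases M) (simp add: cross_def comb_def)
qed

text \<open>\<open>M\<close> is the chord or the tangent: all admissible lines are proportional to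
  it, which reduces the claim to \<open>line_section_unique\<close>.\<close>

lemma third_pointI:
  assumes "line_section a L P Q R" "M \<noteq> (0, 0, 0)"
    and "\<And>L R. line_section a L P Q R \<Longrightarrow> cross M L = (0, 0, 0)"
  shows "third_point a P Q = R"
  unfolding third_point_def
proof (rule the_equality)
  show "\<exists>L. line_section a L P Q R" using assms(1) by blast
  show "R' = R" if "\<exists>L. line_section a L P Q R'" for R'
    using that assms line_section_unique cross_eq_0_trans by metis
qed

text \<open>Multiplicity at least 2 kills the linear coefficient along \<open>L\<close>, which is
  the gradient paired with the direction. So \<open>L\<close> is the tangent once the gradient is
  nonzero.\<close>

lemma line_section_tangent:
  assumes "line_section a L (point p) (point p) R" "p \<noteq> (0, 0, 0)" "hessian_form a p = 0"
  shows "cross (hessian_gradient a p) L = (0, 0, 0)"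
proof -
  let ?g = "hessian_gradient a p"
  have p: "homogeneous_coords p (point p)" using assms(2) by (rule homogeneous_coords_point)
  have L: "L \<noteq> (0, 0, 0)" "dot L p = 0"
    using assms(1) on_line_iff[OF p] by (auto simp: line_section_def)
  have g: "dot ?g w = 0" if w: "dot L w = 0" for w
  proof (cases "cross p w = (0, 0, 0)")
    case True
    then obtain c where "w = comb c p 0 (0, 0, 0)"
      using proportional_if_cross_eq_0 assms(2) by blast
    thus ?thesis using assms(3) by (simp add: dot_comb dot_hessian_gradient)
  next
    case False
    have "Polynomial.order 0 (restrict_form a p w) \<ge> 2"
      and "restrict_form a p w \<noteq> 0"
      using line_section_count[OF assms(1) p L(2) w False] by simp_all
    hence "monom 1 2 dvd restrict_form a p w"
      by (simp add: monom_1_dvd_iff)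
    hence "coeff (restrict_form a p w) 1 = 0"
      by (simp add: monom_1_dvd_iff')
    moreover have "restrict_form a p w = restrict_form a (comb 1 p 0 w) (comb 0 p 1 w)" by simp
    ultimately show ?thesis
      unfolding restrict_form_comb by (simp add: assms(3) power2_eq_square power3_eq_cube)
  qed
  have "dot (cross ?g L) e = dot ?g (cross L e)" for e
    by (cases ?g; cases L; cases e) (simp add: cross_def dot_def algebra_simps)
  hence "dot (cross ?g L) e = 0" for e
    using g dot_commute dot_cross(1) by metis
  thus ?thesis using ex_dot_neq_0 by blast
qed

section \<open>Third points of chords and tangents\<close>

lemma hessian_form_scale: "hessian_form a (comb c v 0 (0, 0, 0)) = c ^ 3 * hessian_form a v"
  by (cases v) (simp add: hessian_form_def comb_def algebra_simps eval_nat_numeral)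

lemma point_scale:
  fixes v :: "'a::field triple"
  assumes "v \<noteq> (0, 0, 0)" "c \<noteq> 0"
  shows "point (comb c v 0 (0, 0, 0)) = point v"
  using assms point_eq_iff_cross[of "comb c v 0 (0, 0, 0)" v]
  by (simp add: comb_eq_0_iff) (cases v, simp add: comb_def cross_def)

lemma line_section_commute: "line_section a L P Q R \<longleftrightarrow> line_section a L Q P R"
proof -
  have "{#P, Q, R#} = {#Q, P, R#}" by simp
  thus ?thesis by (simp only: line_section_def conj_ac)
qed

text \<open>The restricted cubic is \<open>\<alpha> \<beta> (A \<alpha> + C \<beta>)\<close>, with
  third zero \<open>C p - A q\<close>. As \<open>c\<close> and \<open>r\<close> are nonzero, the
  line is not contained in the curve.\<close>

lemma third_point_chord:
  fixes p q :: "'a::field triple"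
  assumes indep: "cross p q \<noteq> (0, 0, 0)"
    and curve: "hessian_form a p = 0" "hessian_form a q = 0"
    and third: "comb (dot (hessian_gradient a q) p) p (- dot (hessian_gradient a p) q) q
      = comb c r 0 (0, 0, 0)" "c \<noteq> 0" "r \<noteq> (0, 0, 0)"
  shows "third_point a (point p) (point q) = point r" "third_point a (point q) (point p) = point r"
    "hessian_form a r = 0"
proof -
  let ?A = "dot (hessian_gradient a p) q" and ?C = "dot (hessian_gradient a q) p"
  have nz: "p \<noteq> (0, 0, 0)" "q \<noteq> (0, 0, 0)" using neq_0_if_cross_neq_0[OF indep] .
  have AC: "?A \<noteq> 0 \<or> ?C \<noteq> 0"
  proof (rule ccontr)
    assume "\<not> ?thesis"
    hence "?A = 0" "?C = 0" by auto
    hence "comb c r 0 (0, 0, 0) = (0, 0, 0)"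
      unfolding third(1)[symmetric] by simp
    thus False using third(2) comb_eq_0_iff[OF third(3)] by simp
  qed
  have "point (comb 0 p (-1) q) = point (comb (-1) q 0 (0, 0, 0))"
    by (cases p; cases q) (simp add: comb_def)
  also have "\<dots> = point q" using nz by (simp add: point_scale)
  finally have q: "point (comb 0 p (-1) q) = point q" .
  have "line_section a (cross p q)
    (point (comb 1 p (- 0) q)) (point (comb 0 p (- 1) q)) (point (comb ?C p (- ?A) q))"
    by (rule line_section_if_form_splits) (use indep AC curve in auto)
  hence sec: "line_section a (cross p q) (point p) (point q) (point r)"
    using third by (simp add: q point_scale)
  have *: "cross (cross p q) L = (0, 0, 0)"
    if "line_section a L (point p) (point q) R" for L R
  proof -
    have "on_line L (point p)" "on_line L (point q)"
      using that unfolding line_section_def by blast+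
    hence "dot L p = 0" "dot L q = 0"
      using nz on_line_iff homogeneous_coords_point by blast+
    thus ?thesis by (simp add: cross_cross dot_commute)
  qed
  show "third_point a (point p) (point q) = point r"
    using third_pointI[OF sec indep] * by blast
  thus "third_point a (point q) (point p) = point r"
    by (simp add: third_point_def line_section_commute[of a _ "point q"])
  have "c ^ 3 * hessian_form a r = hessian_form a (comb ?C p (- ?A) q)"
    by (simp only: third(1) hessian_form_scale)
  also have "\<dots> = 0"
    unfolding hessian_form_comb
    by (simp add: curve algebra_simps power2_eq_square power3_eq_cube)
  finally have "c ^ 3 * hessian_form a r = 0" .
  thus "hessian_form a r = 0" using third by simp
qed

text \<open>Tangency leaves \<open>\<beta>^2 (C \<alpha> + D \<beta>)\<close>: a double zero at
  \<open>p\<close> and the third zero \<open>D p - C n\<close>.\<close>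

lemma third_point_tangent:
  fixes p n :: "'a::field triple"
  assumes indep: "cross p n \<noteq> (0, 0, 0)"
    and curve: "hessian_form a p = 0" "hessian_gradient a p \<noteq> (0, 0, 0)"
      "dot (hessian_gradient a p) n = 0"
    and third: "comb (hessian_form a n) p (- dot (hessian_gradient a n) p) n
      = comb c r 0 (0, 0, 0)" "c \<noteq> 0" "r \<noteq> (0, 0, 0)"
  shows "third_point a (point p) (point p) = point r" "hessian_form a r = 0"
proof -
  let ?D = "hessian_form a n" and ?C = "dot (hessian_gradient a n) p"
  have nz: "p \<noteq> (0, 0, 0)" using neq_0_if_cross_neq_0[OF indep] by simp
  have CD: "?C \<noteq> 0 \<or> ?D \<noteq> 0"
  proof (rule ccontr)
    assume "\<not> ?thesis"
    hence "?C = 0" "?D = 0" by auto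
    hence "comb c r 0 (0, 0, 0) = (0, 0, 0)"
      unfolding third(1)[symmetric] by simp
    thus False using third(2) comb_eq_0_iff[OF third(3)] by simp
  qed
  have "line_section a (cross p n)
    (point (comb 1 p (- 0) n)) (point (comb 1 p (- 0) n)) (point (comb ?D p (- ?C) n))"
    by (rule line_section_if_form_splits) (use indep CD curve in auto)
  hence "line_section a (cross p n) (point p) (point p) (point r)"
    using third by (simp add: point_scale)
  thus "third_point a (point p) (point p) = point r"
    using third_pointI line_section_tangent curve nz by blast
  have "c ^ 3 * hessian_form a r = hessian_form a (comb ?D p (- ?C) n)"
    by (simp only: third(1) hessian_form_scale)
  also have "\<dots> = 0"
    unfolding hessian_form_comb
    by (simp add: curve algebra_simps power2_eq_square power3_eq_cube)
  finally have "c ^ 3 * hessian_form a r = 0" .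
  thus "hessian_form a r = 0" using third by simp
qed

section \<open>Doubling and tripling\<close>

definition tangent_third :: "'a::comm_ring_1 \<Rightarrow> 'a triple \<Rightarrow> 'a triple" where
  "tangent_third a = (\<lambda>(x, y, z).
     (x * (y ^ 3 - z ^ 3), y * (z ^ 3 - a * x ^ 3), z * (a * x ^ 3 - y ^ 3)))"

text \<open>Negation on the curve: the line through \<open>O\<close> and \<open>(x : y : z)\<close>
  meets it again in \<open>(x : z : y)\<close>.\<close>

definition swap_yz :: "'a triple \<Rightarrow> 'a triple" where
  "swap_yz = (\<lambda>(x, y, z). (x, z, y))"

lemma swap_yz_neq_0_iff [simp]: "swap_yz p = (0, 0, 0 :: 'b::zero) \<longleftrightarrow> p = (0, 0, 0)"
  by (cases p) (auto simp: swap_yz_def)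

lemma swap_yz_swap_yz [simp]: "swap_yz (swap_yz p) = p"
  by (cases p) (simp add: swap_yz_def)

lemma hessian_form_swap_yz [simp]: "hessian_form a (swap_yz p) = hessian_form a p"
  by (cases p) (simp add: swap_yz_def hessian_form_def algebra_simps)

text \<open>The second coordinate is \<open>u\<^sup>2v + v\<^sup>2w + w\<^sup>2u - 3uvw\<close> and the third is its image under
  \<open>u \<leftrightarrow> v\<close>; both are expanded around \<open>w\<close> so that \<open>N\<close> can be shared with the first coordinate
  \<open>u\<^sup>3 + v\<^sup>3 + w\<^sup>3 - 3uvw\<close>.\<close>

definition triple_coords :: "'a::comm_ring_1 \<Rightarrow> 'a triple \<Rightarrow> 'a triple" where
  "triple_coords a = (\<lambda>(x, y, z).
     let u = a * x ^ 3; v = y ^ 3; w = z ^ 3; s = u - w; q = v - w; N = (s - q) ^ 2 + s * q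
     in ((u + v + w) * N, w * N + s * q * s, w * N + s * q * q))"

text \<open>If \<open>g\<close> is the gradient at \<open>p\<close>, then \<open>g \<times> e\<close> is on the tangent line at \<open>p\<close> for every \<open>e\<close>,
  and it differs from \<open>p\<close> unless the coordinate \<open>p \<cdot> e\<close> vanishes. Its restricted form is
  \<open>\<alpha>\<beta>\<^sup>2C + \<beta>\<^sup>3D\<close>, with third root \<open>D p - C n\<close>. Choosing \<open>n\<close> this way also covers the flexes,
  where the third point is \<open>p\<close> itself. A point of the curve has \<open>y \<noteq> 0\<close> or \<open>z \<noteq> 0\<close>, so two
  choices of \<open>e\<close> suffice.\<close>

lemma tangent_identity_z:
  assumes F: "hessian_form a (x, y, z) = 0" and n: "(g1, g2, g3) = hessian_gradient a (x, y, z)"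
  shows "comb (hessian_form a (g2, - g1, 0)) (x, y, z)
      (- dot (hessian_gradient a (g2, - g1, 0)) (x, y, z)) (g2, - g1, 0)
    = comb ((27 * a - 1) * z ^ 3) (tangent_third a (x, y, z)) 0 (0, 0, 0)"
proof -
  have g: "g1 = 3 * a * x ^ 2 - y * z" "g2 = 3 * y ^ 2 - x * z"
    using n by (simp_all add: hessian_gradient_def)
  \<comment> \<open>The cofactor of the form is the quotient by the curve equation; given
    explicitly, it turns a claim on the curve into a polynomial identity.\<close>
  have "hessian_form a (g2, - g1, 0) * x - dot (hessian_gradient a (g2, - g1, 0)) (x, y, z) * g2
    = (27 * a - 1) * z ^ 3 * (x * (y ^ 3 - z ^ 3)) + hessian_form a (x, y, z) *
      (- (27*a^2*x^4) + 27*a*x^2*y*z - 54*a*x*y^3 + 27*a*x*z^3 - x*z^3)"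
    by (simp add: g hessian_form_def hessian_gradient_def dot_def algebra_simps eval_nat_numeral)
  moreover have "hessian_form a (g2, - g1, 0) * y - dot (hessian_gradient a (g2, - g1, 0)) (x, y, z) * (- g1)
    = (27 * a - 1) * z ^ 3 * (y * (z ^ 3 - a * x ^ 3)) + hessian_form a (x, y, z) *
      (54*a^2*x^3*y - 27*a*x*y^2*z + 27*a*y^4 - 27*a*y*z^3 + y*z^3)"
    by (simp add: g hessian_form_def hessian_gradient_def dot_def algebra_simps eval_nat_numeral)
  moreover have "hessian_form a (g2, - g1, 0) * z
    = (27 * a - 1) * z ^ 3 * (z * (a * x ^ 3 - y ^ 3)) + hessian_form a (x, y, z) *
      (27*a*y^3*z - 27*a^2*x^3*z)"
    by (simp add: g hessian_form_def algebra_simps eval_nat_numeral)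
  ultimately show ?thesis using F
    by (simp add: comb_def tangent_third_def)
qed

text \<open>Mirror image of \<open>tangent_identity_z\<close> under exchanging \<open>y\<close> and
  \<open>z\<close>, which changes the sign of the cofactor; it serves the points with
  \<open>z = 0\<close>.\<close>

lemma tangent_identity_y:
  assumes F: "hessian_form a (x, y, z) = 0" and n: "(g1, g2, g3) = hessian_gradient a (x, y, z)"
  shows "comb (hessian_form a (g3, 0, - g1)) (x, y, z)
      (- dot (hessian_gradient a (g3, 0, - g1)) (x, y, z)) (g3, 0, - g1)
    = comb ((1 - 27 * a) * y ^ 3) (tangent_third a (x, y, z)) 0 (0, 0, 0)"
proof -
  have g: "g1 = 3 * a * x ^ 2 - y * z" "g3 = 3 * z ^ 2 - x * y"
    using n by (simp_all add: hessian_gradient_def)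
  have "hessian_form a (g3, 0, - g1) * x - dot (hessian_gradient a (g3, 0, - g1)) (x, y, z) * g3
    = (1 - 27 * a) * y ^ 3 * (x * (y ^ 3 - z ^ 3)) + hessian_form a (x, y, z) *
      (- (27*a^2*x^4) + 27*a*x^2*y*z + 27*a*x*y^3 - 54*a*x*z^3 - x*y^3)"
    by (simp add: g hessian_form_def hessian_gradient_def dot_def algebra_simps eval_nat_numeral)
  moreover have "hessian_form a (g3, 0, - g1) * y
    = (1 - 27 * a) * y ^ 3 * (y * (z ^ 3 - a * x ^ 3)) + hessian_form a (x, y, z) *
      (27*a*y*z^3 - 27*a^2*x^3*y)"
    by (simp add: g hessian_form_def algebra_simps eval_nat_numeral)
  moreover have "hessian_form a (g3, 0, - g1) * z - dot (hessian_gradient a (g3, 0, - g1)) (x, y, z) * (- g1)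
    = (1 - 27 * a) * y ^ 3 * (z * (a * x ^ 3 - y ^ 3)) + hessian_form a (x, y, z) *
      (54*a^2*x^3*z - 27*a*x*y*z^2 - 27*a*y^3*z + 27*a*z^4 + y^3*z)"
    by (simp add: g hessian_form_def hessian_gradient_def dot_def algebra_simps eval_nat_numeral)
  ultimately show ?thesis using F
    by (simp add: comb_def tangent_third_def)
qed

text \<open>The cofactor \<open>x + 3y + 3z\<close> is the tangent at the flex \<open>O\<close>: the chord through \<open>P\<close> and \<open>2P\<close>
  degenerates exactly at \<open>P = O\<close>.\<close>

lemma chord_identity:
  assumes F: "hessian_form a (x, y, z) = 0" and q: "q = swap_yz (tangent_third a (x, y, z))"
  shows "comb (dot (hessian_gradient a q) (x, y, z)) (x, y, z) (- dot (hessian_gradient a (x, y, z)) q) q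
    = comb (x + 3 * y + 3 * z) (swap_yz (triple_coords a (x, y, z))) 0 (0, 0, 0)"
proof -
  define A where "A = dot (hessian_gradient a (x, y, z)) q"
  define C where "C = dot (hessian_gradient a q) (x, y, z)"
  obtain r1 r2 r3 where r: "triple_coords a (x, y, z) = (r1, r2, r3)" by (cases "triple_coords a (x, y, z)")
  note defs = A_def C_def q hessian_form_def hessian_gradient_def dot_def tangent_third_def swap_yz_def
  have r1: "r1 = (a * x ^ 3 + y ^ 3 + z ^ 3) * ((a * x ^ 3 - y ^ 3) ^ 2 + (a * x ^ 3 - z ^ 3) * (y ^ 3 - z ^ 3))"
   and r2: "r2 = z ^ 3 * ((a * x ^ 3 - y ^ 3) ^ 2 + (a * x ^ 3 - z ^ 3) * (y ^ 3 - z ^ 3))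
      + (a * x ^ 3 - z ^ 3) ^ 2 * (y ^ 3 - z ^ 3)"
   and r3: "r3 = z ^ 3 * ((a * x ^ 3 - y ^ 3) ^ 2 + (a * x ^ 3 - z ^ 3) * (y ^ 3 - z ^ 3))
      + (a * x ^ 3 - z ^ 3) * (y ^ 3 - z ^ 3) ^ 2"
    using r by (auto simp: triple_coords_def Let_def power2_eq_square mult_ac)
  have "C * x - A * (x * (y ^ 3 - z ^ 3)) = (x + 3 * y + 3 * z) * r1 + hessian_form a (x, y, z) *
    (- (a^2*x^7) - 3*a^2*x^6*y - 3*a^2*x^6*z + a*x^4*y^3 + a*x^4*z^3 + 3*a*x^3*y^4 + 3*a*x^3*y^3*z
     + 3*a*x^3*y*z^3 + 3*a*x^3*z^4 - x*y^6 + x*y^3*z^3 - x*z^6 - 3*y^7 - 3*y^6*z + 3*y^4*z^3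
     + 3*y^3*z^4 - 3*y*z^6 - 3*z^7)"
    by (simp add: defs r1 algebra_simps eval_nat_numeral)
  moreover have "C * y - A * (z * (a * x ^ 3 - y ^ 3)) = (x + 3 * y + 3 * z) * r3"
    by (simp add: defs r3 algebra_simps eval_nat_numeral)
  moreover have "C * z - A * (y * (z ^ 3 - a * x ^ 3)) = (x + 3 * y + 3 * z) * r2"
    by (simp add: defs r2 algebra_simps eval_nat_numeral)
  ultimately show ?thesis using F unfolding A_def [symmetric] C_def [symmetric]
    by (simp add: comb_def r swap_yz_def q tangent_third_def)
qed

section \<open>Smoothness and nonvanishing of the formulas\<close>

locale smooth_hessian =
  fixes a :: "'a::field"
  assumes a_nz: "a \<noteq> 0" and a27: "1 - 27 * a \<noteq> 0"
begin

text \<open>With \<open>u = v = w\<close> the curve gives \<open>xyz = 3w\<close>, and cubing yields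
  \<open>w^3 = 27 a w^3\<close>. This is the degenerate case of both the doubling and the tripling
  formula.\<close>

lemma coords_eq_0:
  assumes "hessian_form a (x, y, z) = 0" "a * x ^ 3 = y ^ 3" "y ^ 3 = z ^ 3"
  shows "x = 0 \<and> y = 0 \<and> z = 0"
proof -
  have z: "x * y * z = 3 * z ^ 3"
    using assms by (simp add: hessian_form_def algebra_simps)
  have "z ^ 9 = a * x ^ 3 * y ^ 3 * z ^ 3"
    unfolding assms by (simp add: assms(3) eval_nat_numeral)
  also have "\<dots> = a * (x * y * z) ^ 3" by (simp add: power_mult_distrib)
  also have "\<dots> = 27 * a * z ^ 9" unfolding z by (simp add: power_mult_distrib)
  finally have "(1 - 27 * a) * z ^ 9 = 0" by (simp add: algebra_simps)
  thus ?thesis using assms a27 a_nz by simp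
qed

text \<open>Multiplying the three equations gives \<open>(xyz)^2 = 27 a (xyz)^2\<close>, so some
  coordinate vanishes. The curve equation finishes the argument even in characteristic 3, where the
  gradient is also zero at \<open>(1, 0, 0)\<close>.\<close>

lemma hessian_gradient_neq_0:
  assumes "hessian_form a p = 0" "p \<noteq> (0, 0, 0)"
  shows "hessian_gradient a p \<noteq> (0, 0, 0)"
proof
  assume g: "hessian_gradient a p = (0, 0, 0)"
  obtain x y z where p: "p = (x, y, z)" by (cases p)
  have g: "3 * a * x ^ 2 = y * z" "3 * y ^ 2 = x * z" "3 * z ^ 2 = x * y"
    using g by (simp_all add: p hessian_gradient_def)
  have F: "a * x ^ 3 + y ^ 3 + z ^ 3 = x * y * z"
    using assms(1) by (simp add: p hessian_form_def)
  have "x * y * z * (x * y * z) ^ 2 = (3 * a * x ^ 2) * (3 * y ^ 2) * (3 * z ^ 2) * (x * y * z)"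
    unfolding g by (simp add: algebra_simps eval_nat_numeral)
  hence "(1 - 27 * a) * (x * y * z) ^ 3 = 0"
    by (simp add: algebra_simps eval_nat_numeral)
  hence "x = 0 \<or> y = 0 \<or> z = 0" using a27 by simp
  thus False
    using g F a_nz assms(2) by (auto simp: p)
qed

lemma tangent_third_neq_0:
  assumes "hessian_form a p = 0" "p \<noteq> (0, 0, 0)"
  shows "tangent_third a p \<noteq> (0, 0, 0)"
proof
  assume T: "tangent_third a p = (0, 0, 0)"
  obtain x y z where p: "p = (x, y, z)" by (cases p)
  have F: "a * x ^ 3 + y ^ 3 + z ^ 3 = x * y * z"
    using assms(1) by (simp add: p hessian_form_def)
  have T: "x = 0 \<or> y ^ 3 = z ^ 3" "y = 0 \<or> z ^ 3 = a * x ^ 3" "z = 0 \<or> a * x ^ 3 = y ^ 3"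
    using T by (auto simp: p tangent_third_def)
  consider "x \<noteq> 0" "y \<noteq> 0" "z \<noteq> 0" | "x = 0" | "y = 0" | "z = 0" by blast
  hence "x = 0 \<and> y = 0 \<and> z = 0"
  proof cases
    case 1
    thus ?thesis using T assms(1) coords_eq_0[of x y z] by (simp add: p)
  next
    case 2
    thus ?thesis using T F by (elim disjE) simp_all
  next
    case 3
    thus ?thesis using T F a_nz by (elim disjE) simp_all
  next
    case 4
    thus ?thesis using T F a_nz by (elim disjE) simp_all
  qed
  thus False using assms(2) by (simp add: p)
qed

text \<open>There are no exceptional points: by \<open>uvw = a (u + v + w)^3\<close> the three
  outputs vanish together only for \<open>u = v = w\<close>, which \<open>coords_eq_0\<close>
  excludes.\<close>

lemma triple_coords_neq_0:
  assumes "hessian_form a p = 0" "p \<noteq> (0, 0, 0)"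
  shows "triple_coords a p \<noteq> (0, 0, 0)"
proof
  assume T: "triple_coords a p = (0, 0, 0)"
  obtain x y z where p: "p = (x, y, z)" by (cases p)
  define u v w where "u = a * x ^ 3" and "v = y ^ 3" and "w = z ^ 3"
  have F: "u + v + w = x * y * z"
    using assms(1) by (simp add: p hessian_form_def u_def v_def w_def)
  hence cubic: "u * v * w = a * (u + v + w) ^ 3"
    by (simp add: u_def v_def w_def power_mult_distrib)
  define N where "N = (u - w - (v - w)) ^ 2 + (u - w) * (v - w)"
  have T: "(u + v + w) * N = 0" "w * N + (u - w) * (v - w) * (u - w) = 0"
    "w * N + (u - w) * (v - w) * (v - w) = 0"
    using T by (simp_all add: p triple_coords_def Let_def u_def v_def w_def N_def)
  have "u = w \<and> v = w"
  proof (cases "N = 0")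
    case True
    hence "(u - w) * (v - w) * (u - w) = 0" using T(2) by simp
    hence "u = w \<or> v = w" by auto
    thus ?thesis using True by (auto simp: N_def)
  next
    case False
    hence e: "u + v + w = 0" using T by simp
    hence "u = 0 \<or> v = 0 \<or> w = 0" using cubic by simp
    then consider "w = 0" "v = - u" | "u = 0" "w = - v" | "v = 0" "w = - u"
      using e by (auto simp: add_eq_0_iff)
    thus ?thesis
    proof cases
      case 1
      thus ?thesis using T(2) by (simp add: N_def)
    next
      case 2
      \<comment> \<open>The multiples of \<open>v^3\<close> add up to -1, so the characteristic does
        not matter.\<close>
      have "w * N + (u - w) * (v - w) * (u - w) = - (v ^ 3)"
        by (simp add: 2 N_def algebra_simps eval_nat_numeral)
      thus ?thesis using T(2) 2 by simp
    next
      case 3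
      have "w * N + (u - w) * (v - w) * (v - w) = - (u ^ 3)"
        by (simp add: 3 N_def algebra_simps eval_nat_numeral)
      thus ?thesis using T(3) 3 by simp
    qed
  qed
  thus False
    using coords_eq_0[of x y z] assms by (simp add: p u_def v_def w_def)
qed

section \<open>The group law in coordinates\<close>

lemma third_point_zero_zero: "third_point a hessian_zero hessian_zero = hessian_zero"
  unfolding hessian_zero_def
\<comment> \<open>\<open>n\<close> is another point of the tangent \<open>x + 3y + 3z = 0\<close> at
  \<open>O\<close>. The form has value \<open>27 * a - 1\<close> there and \<open>C = 0\<close>, so
  the third zero is \<open>O\<close> again: a flex.\<close>
proof (rule third_point_tangent(1)[where n = "(3, -1, 0)" and c = "27 * a - 1"])
  show "hessian_gradient a (0, 1, - 1) \<noteq> (0, 0, 0)"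
    by (rule hessian_gradient_neq_0) (simp_all add: hessian_form_def)
qed (use a27 in \<open>simp_all add: cross_def hessian_form_def dot_def hessian_gradient_def comb_def\<close>)

text \<open>On the tangent at \<open>O\<close> the form restricts to
  \<open>(1 - 27 * a) * (y + z) ^ 3\<close>, so that line meets the curve only at
  \<open>O\<close>.\<close>

lemma flex_tangent_neq_0:
  assumes "hessian_form a (x, y, z) = 0" "cross (x, y, z) (0, 1, - 1) \<noteq> (0, 0, 0)"
  shows "x + 3 * y + 3 * z \<noteq> 0"
proof
  assume "x + 3 * y + 3 * z = 0"
  hence x: "x = - 3 * (y + z)" by (simp add: algebra_simps add_eq_0_iff)
  have "hessian_form a (x, y, z) = (1 - 27 * a) * (y + z) ^ 3"
    unfolding x by (simp add: hessian_form_def algebra_simps eval_nat_numeral)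
  hence "y + z = 0" using assms(1) a27 by simp
  thus False using assms(2) x by (simp add: cross_def add_eq_0_iff)
qed

text \<open>Both chord coefficients contain the factor \<open>x + 3y + 3z\<close>; cancelling it
  leaves \<open>(x, z, y)\<close>. At \<open>O\<close> itself the flex property takes over.\<close>

lemma third_point_zero:
  assumes F: "hessian_form a p = 0" and p0: "p \<noteq> (0, 0, 0)"
  shows "third_point a hessian_zero (point p) = point (swap_yz p)"
    and "third_point a (point p) hessian_zero = point (swap_yz p)"
proof -
  obtain x y z where p: "p = (x, y, z)" by (cases p)
  have "third_point a hessian_zero (point p) = point (swap_yz p)
      \<and> third_point a (point p) hessian_zero = point (swap_yz p)"
  proof (cases "cross p (0, 1, - 1) = (0, 0, 0)")
    case True
    hence "point p = hessian_zero"
      unfolding hessian_zero_def using point_eq_iff_cross[OF p0, of "(0, 1, - 1)"] by simp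
    moreover have "cross (swap_yz p) (0, 1, - 1) = (0, 0, 0)"
      using True by (auto simp: p cross_def swap_yz_def add_eq_0_iff)
    hence "point (swap_yz p) = hessian_zero"
      unfolding hessian_zero_def using point_eq_iff_cross[of "swap_yz p" "(0, 1, - 1)"] p0 by simp
    ultimately show ?thesis using third_point_zero_zero by simp
  next
    case False
    have "comb (dot (hessian_gradient a (0, 1, - 1)) p) p (- dot (hessian_gradient a p) (0, 1, - 1)) (0, 1, - 1)
      = comb (x + 3 * y + 3 * z) (swap_yz p) 0 (0, 0, 0)"
      by (simp add: p comb_def dot_def hessian_gradient_def swap_yz_def algebra_simps power2_eq_square)
    from third_point_chord[OF False F _ this] show ?thesis
      using flex_tangent_neq_0[of x y z] F False p0
      unfolding hessian_zero_def by (simp add: p hessian_form_def)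
  qed
  thus "third_point a hessian_zero (point p) = point (swap_yz p)"
    "third_point a (point p) hessian_zero = point (swap_yz p)" by blast+
qed

lemma hessian_add_eqI:
  assumes "third_point a P Q = point r" "hessian_form a r = 0" "r \<noteq> (0, 0, 0)"
  shows "hessian_add a P Q = point (swap_yz r)"
  unfolding hessian_add_def assms(1) by (rule third_point_zero(1)) fact+

lemma hessian_add_zero:
  assumes "hessian_form a p = 0" "p \<noteq> (0, 0, 0)"
  shows "hessian_add a (point p) hessian_zero = point p"
  using hessian_add_eqI[OF third_point_zero(2)[OF assms]] assms by simp

lemma third_point_self:
  assumes F: "hessian_form a p = 0" and p0: "p \<noteq> (0, 0, 0)"
  shows "third_point a (point p) (point p) = point (tangent_third a p)"
    and "hessian_form a (tangent_third a p) = 0"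
proof -
  obtain x y z where p: "p = (x, y, z)" by (cases p)
  obtain g1 g2 g3 where g: "(g1, g2, g3) = hessian_gradient a p" by (metis prod_cases3)
  have g0: "hessian_gradient a p \<noteq> (0, 0, 0)" using F p0 by (rule hessian_gradient_neq_0)
  have "dot (hessian_gradient a p) p = 3 * hessian_form a p"
    by (rule dot_hessian_gradient)
  hence euler: "g1 * x + g2 * y + g3 * z = 0"
    using F by (simp add: p dot_def flip: g[unfolded p])
  have T0: "tangent_third a p \<noteq> (0, 0, 0)" using F p0 by (rule tangent_third_neq_0)
  have yz: "y \<noteq> 0 \<or> z \<noteq> 0"
    using F p0 a_nz by (auto simp: p hessian_form_def)
  have "third_point a (point p) (point p) = point (tangent_third a p)
      \<and> hessian_form a (tangent_third a p) = 0"
  proof (cases "z = 0")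
    case False
    \<comment> \<open>Euler's relation makes \<open>cross p n\<close> equal to \<open>z\<close>
      times the gradient, hence nonzero by smoothness.\<close>
    have "g3 * z = (g1 * x + g2 * y + g3 * z) - g1 * x - g2 * y" by simp
    hence "g3 * z = - (g1 * x) - g2 * y" unfolding euler by simp
    hence "cross p (g2, - g1, 0) = comb z (hessian_gradient a p) 0 (0, 0, 0)"
      by (simp add: p cross_def comb_def mult.commute flip: g[unfolded p])
    hence indep: "cross p (g2, - g1, 0) \<noteq> (0, 0, 0)"
      using False comb_eq_0_iff[OF g0] by simp
    show ?thesis
      using third_point_tangent[OF indep F g0 _ tangent_identity_z[of a x y z g1 g2 g3, folded p, OF F g]]
        False a27 T0 by (simp add: dot_def flip: g)
  next
    case True
    have "g1 * x = (g1 * x + g2 * y + g3 * z) - g2 * y - g3 * z" by simp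
    hence "g1 * x = - (g2 * y) - g3 * z" unfolding euler by simp
    hence "cross p (g3, 0, - g1) = comb (- y) (hessian_gradient a p) 0 (0, 0, 0)"
      by (simp add: p cross_def comb_def mult.commute flip: g[unfolded p])
    hence indep: "cross p (g3, 0, - g1) \<noteq> (0, 0, 0)"
      using yz True comb_eq_0_iff[OF g0] by simp
    show ?thesis
      using third_point_tangent[OF indep F g0 _ tangent_identity_y[of a x y z g1 g2 g3, folded p, OF F g]]
        True yz a27 T0 by (simp add: dot_def flip: g)
  qed
  thus "third_point a (point p) (point p) = point (tangent_third a p)"
    "hessian_form a (tangent_third a p) = 0" by blast+
qed

lemma hessian_mult_3:
  assumes F: "hessian_form a p = 0" and p0: "p \<noteq> (0, 0, 0)"
  shows "hessian_mult a 3 (point p) = point (triple_coords a p)"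
proof -
  obtain x y z where p: "p = (x, y, z)" by (cases p)
  define q where "q = swap_yz (tangent_third a p)"
  have q0: "q \<noteq> (0, 0, 0)" and Fq: "hessian_form a q = 0"
    using tangent_third_neq_0[OF assms] third_point_self(2)[OF assms] by (simp_all add: q_def)
  have R0: "swap_yz (triple_coords a p) \<noteq> (0, 0, 0)"
    using triple_coords_neq_0[OF assms] by simp
  have double: "hessian_add a (point p) (point p) = point q"
    unfolding q_def
    by (rule hessian_add_eqI) (use third_point_self[OF assms] tangent_third_neq_0[OF assms] in auto)
  have mult: "hessian_mult a 3 (point p) = hessian_add a (point p) (point q)"
    by (simp add: hessian_mult_def eval_nat_numeral hessian_add_zero[OF assms] double)
  note chord = chord_identity[of a x y z q, folded p, OF F q_def]
  show ?thesis
  proof (cases "cross p (0, 1, - 1) = (0, 0, 0)")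
    case True
    hence P: "point p = hessian_zero"
      unfolding hessian_zero_def using point_eq_iff_cross[OF p0, of "(0, 1, - 1)"] by simp
    have "hessian_add a hessian_zero hessian_zero = hessian_zero"
      by (simp add: hessian_add_def third_point_zero_zero)
    hence "hessian_mult a 3 (point p) = hessian_zero"
      by (simp add: P hessian_mult_def eval_nat_numeral)
    moreover have "x = 0" "y = - z"
      using True by (auto simp: p cross_def add_eq_0_iff)
    hence "cross (triple_coords a p) (0, 1, - 1) = (0, 0, 0)"
      by (simp add: p triple_coords_def Let_def cross_def algebra_simps eval_nat_numeral)
    hence "point (triple_coords a p) = hessian_zero"
      unfolding hessian_zero_def
      using point_eq_iff_cross[OF triple_coords_neq_0[OF assms], of "(0, 1, - 1)"] by simp
    ultimately show ?thesis by simp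
  next
    case False
    hence l: "x + 3 * y + 3 * z \<noteq> 0" using F flex_tangent_neq_0 by (simp add: p)
    \<comment> \<open>If \<open>P = 2P\<close>, Euler's relation kills both chord coefficients,
      whereas the right side of \<open>chord\<close> is nonzero away from \<open>O\<close>.\<close>
    have "cross p q \<noteq> (0, 0, 0)"
    proof
      assume "cross p q = (0, 0, 0)"
      then obtain c where c: "q = comb c p 0 (0, 0, 0)"
        using proportional_if_cross_eq_0 p0 by blast
      have "hessian_gradient a q = comb (c ^ 2) (hessian_gradient a p) 0 (0, 0, 0)"
        unfolding c p by (simp add: hessian_gradient_def comb_def algebra_simps power2_eq_square)
      hence "dot (hessian_gradient a q) p = 0" "dot (hessian_gradient a p) q = 0"
        using dot_hessian_gradient[of a p] F by (simp_all add: c dot_comb dot_commute[of _ p])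
      hence "comb (x + 3 * y + 3 * z) (swap_yz (triple_coords a p)) 0 (0, 0, 0) = (0, 0, 0)"
        using chord by simp
      thus False using l comb_eq_0_iff[OF R0] by simp
    qed
    from third_point_chord(1,3)[OF this F Fq chord l R0] show ?thesis
      unfolding mult using hessian_add_eqI R0 by fastforce
  qed
qed

end

section \<open>The program\<close>

text \<open>Registers 5, 7, 9 hold \<open>u\<close>, \<open>v\<close>, \<open>w\<close>; 10, 11, 12
  hold \<open>s\<close>, \<open>q\<close>, \<open>sq\<close>; 15 is \<open>N\<close>, 17 is
  \<open>u + v + w\<close>, and 19 is \<open>wN\<close>, shared by the last two outputs.\<close>

definition tripling_program :: slp where
  "tripling_program =
    ([Sqr 0, Mul 0 3, MulConst 4, Sqr 1, Mul 1 6, Sqr 2, Mul 2 8,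
      Sub 5 9, Sub 7 9, Mul 10 11, Sub 10 11, Sqr 13, Add 14 12,
      Add 5 7, Add 16 9, Mul 17 15, Mul 9 15, Mul 12 10, Mul 12 11, Add 19 20, Add 19 21],
     (18, 22, 23))"

lemma run_tripling_program: "run a tripling_program v = triple_coords a v"
  by (cases v)
     (simp add: run_def tripling_program_def triple_coords_def Let_def nth_append
        eval_nat_numeral mult_ac)

lemma well_formed_tripling_program: "well_formed tripling_program"
  by (simp add: well_formed_def tripling_program_def All_less_Suc eval_nat_numeral)

lemma cost_tripling_program:
  "num_mul tripling_program = 8" "num_sqr tripling_program = 4" "num_mul_const tripling_program = 1"
  by (simp_all add: num_mul_def num_sqr_def num_mul_const_def tripling_program_def)

theorem mainTheorem7:
  fixes a :: "'k::field"
  assumes "a * (1 - 27 * a) \<noteq> 0"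
  shows "evaluable_with a (hessian_mult (to_ac a) 3) 8 4 2"
proof -
  \<comment> \<open>\<open>to_ac\<close> is injective, so the hypothesis survives in the algebraic
    closure, where the points live.\<close>
  have "to_ac (a * (1 - 27 * a)) \<noteq> 0"
    using assms to_ac_eq_iff[of "a * (1 - 27 * a)" 0] by (simp del: to_ac_mult)
  then interpret smooth_hessian "to_ac a"
    by unfold_locales auto
  have "homogeneous_coords (run (to_ac a) tripling_program v) (hessian_mult (to_ac a) 3 P)"
    if P: "P \<in> hessian_curve (to_ac a)" and v: "homogeneous_coords v P" for P v
  proof -
    \<comment> \<open>Curve membership provides some coordinates \<open>w\<close> satisfying the
      equation; homogeneity passes it on to the given \<open>v\<close>.\<close>
    obtain w where w: "homogeneous_coords w P" "hessian_form (to_ac a) w = 0"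
      using P by (auto simp: hessian_curve_def)
    have "same_point w v"
      using v w(1) point_eq_iff[of w v] by (simp add: homogeneous_coords_def)
    then obtain c where "v = comb c w 0 (0, 0, 0)"
      using same_point_imp_comb by blast
    hence F: "hessian_form (to_ac a) v = 0" using w(2) by (simp add: hessian_form_scale)
    moreover have v0: "v \<noteq> (0, 0, 0)" and P: "P = point v"
      using v by (auto simp: homogeneous_coords_def)
    ultimately show ?thesis
      using hessian_mult_3[OF F v0] triple_coords_neq_0[OF F v0]
      by (simp add: run_tripling_program homogeneous_coords_def)
  qed
  thus ?thesis
    unfolding evaluable_with_def
    using well_formed_tripling_program cost_tripling_program
    by (intro exI[of _ tripling_program]) auto
qed

end
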